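(* There exists $M>0$ such that for any non-atomic probability measure $\rho$ on $\mathbb{R}_+=(0,\infty)$ with $\rho([1,2])=\rho([3,4])=\rho([M,\infty))=1/3$, the $DDI$-map $T$ associated to $\rho$ is $c$-monotone, i.e. the support of the plan $(\mathrm{Id},T,T^{(2)})_\sharp\rho$ is a $c$-monotone subset of $(\mathbb{R}_+)^3$.
   Context: Notation: $\mathbb{R}_+=(0,\infty)$; $T^{(2)}=T\circ T$; $T_\sharp\rho$ is the push-forward measure. Cost. For $r_1,r_2,r_3\in\mathbb{R}_+$, $$c(r_1,r_2,r_3)=\min\Big\{\frac1{|v_2-v_1|}+\frac1{|v_3-v_2|}+\frac1{|v_1-v_3|}\;:\;v_i\in\mathbb{R}^2,\ |v_i|=r_i,\ i=1,2,3\Big\}.$$ $DDI$-map. Let $\rho$ be a non-atomic probability measure on $\mathbb{R}_+$ and let $d_1,d_2\in\mathbb{R}_+$ be such that $\rho((0,d_1])=\rho([d_1,d_2])=\rho([d_2,\infty))=1/3$. The $DDI$-map associated to $\rho$ is the unique (up to $\rho$-negligible sets) map $T:\mathbb{R}_+\to\mathbb{R}_+$ such that $T_\sharp\rho=\rho$ and $T$ maps $(0,d_1)$ onto $(d_1,d_2)$ decreasingly, $(d_1,d_2)$ onto $(d_2,\infty)$ decreasingly, and $(d_2,\infty)$ onto $(0,d_1)$ increasingly (that is, on each of the three intervals $T$ is the monotone map, with the indicated monotonicity, pushing the restriction of $\rho$ to that interval forward to the restriction of $\rho$ to the target interval; everything is understood up to $\rho$-negligible sets). $c$-monotonicity. For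 $x,y\in(\mathbb{R}_+)^3$ and $p\subseteq\{1,2,3\}$, let $X(x,y,p),Y(x,y,p)\in(\mathbb{R}_+)^3$ be given by $X_i=x_i,\ Y_i=y_i$ if $i\in p$ and $X_i=y_i,\ Y_i=x_i$ if $i\notin p$. A set $\Gamma\subset(\mathbb{R}_+)^3$ is $c$-monotone if $c(x)+c(y)\le c(X(x,y,p))+c(Y(x,y,p))$ for all $x,y\in\Gamma$ and all $p\subseteq\{1,2,3\}$. *)

theory Defs
  imports "HOL-Probability.Probability"
begin

abbreviation Rplus :: "real set" where
  "Rplus \<equiv> {0<..}"

abbreviation Rplus3 :: "(real ^ 3) set" where
  "Rplus3 \<equiv> {x. \<forall>i. x $ i \<in> Rplus}"

(* Since 1 / 0 = 0 in HOL, configurations with coinciding points, whose Coulomb energy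
   is infinite, are excluded explicitly. *)
definition coulomb_energies :: "real \<Rightarrow> real \<Rightarrow> real \<Rightarrow> real set" where
  "coulomb_energies r1 r2 r3 =
     {1 / norm (v2 - v1) + 1 / norm (v3 - v2) + 1 / norm (v1 - v3) | v1 v2 v3 :: real ^ 2.
        norm v1 = r1 \<and> norm v2 = r2 \<and> norm v3 = r3 \<and> v1 \<noteq> v2 \<and> v2 \<noteq> v3 \<and> v3 \<noteq> v1}"

(* For positive radii this infimum is a minimum, see coulomb_cost_minimum below. *)
definition coulomb_cost :: "real \<Rightarrow> real \<Rightarrow> real \<Rightarrow> real" where
  "coulomb_cost r1 r2 r3 = Inf (coulomb_energies r1 r2 r3)"

lemma coulomb_energies_nonempty:
  assumes "r1 > 0" "r2 > 0" "r3 > 0"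
  shows "coulomb_energies r1 r2 r3 \<noteq> {}"
proof -
  define v1 v2 v3 :: "real ^ 2"
    where "v1 = vector [r1, 0]" and "v2 = vector [0, r2]" and "v3 = vector [- r3, 0]"
  have "norm v1 = r1" "norm v2 = r2" "norm v3 = r3"
    using assms by (simp_all add: v1_def v2_def v3_def norm_vec_def L2_set_def sum_2)
  moreover have "v1 $ 1 \<noteq> v2 $ 1" "v2 $ 1 \<noteq> v3 $ 1" "v3 $ 1 \<noteq> v1 $ 1"
    using assms by (simp_all add: v1_def v2_def v3_def)
  ultimately show ?thesis
    unfolding coulomb_energies_def by blast
qed

lemma coulomb_cost_minimum:
  assumes "r1 > 0" "r2 > 0" "r3 > 0"
  shows "coulomb_cost r1 r2 r3 \<in> coulomb_energies r1 r2 r3"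
    and "\<And>e. e \<in> coulomb_energies r1 r2 r3 \<Longrightarrow> coulomb_cost r1 r2 r3 \<le> e"
proof -
  let ?S = "coulomb_energies r1 r2 r3"
  define f where "f = (\<lambda>(v1 :: real ^ 2, v2, v3).
    1 / norm (v2 - v1) + 1 / norm (v3 - v2) + 1 / norm (v1 - v3))"
  have bdd: "bdd_below ?S"
    by (rule bdd_belowI[of _ 0]) (auto simp: coulomb_energies_def)
  then show lower: "\<And>e. e \<in> ?S \<Longrightarrow> coulomb_cost r1 r2 r3 \<le> e"
    unfolding coulomb_cost_def by (rule cInf_lower[rotated])
  obtain w1 w2 w3 :: "real ^ 2" where w: "norm w1 = r1" "norm w2 = r2" "norm w3 = r3"
      "w1 \<noteq> w2" "w2 \<noteq> w3" "w3 \<noteq> w1"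
    using coulomb_energies_nonempty[OF assms] by (auto simp: coulomb_energies_def)
  define F where "F = f (w1, w2, w3)"
  have F_pos: "F > 0"
    using w by (auto simp: F_def f_def intro!: add_pos_pos)
  define K where "K = (sphere 0 r1 \<times> sphere 0 r2 \<times> sphere 0 r3) \<inter>
    {(v1 :: real ^ 2, v2 :: real ^ 2, v3 :: real ^ 2).
       1 / F \<le> norm (v2 - v1) \<and> 1 / F \<le> norm (v3 - v2) \<and> 1 / F \<le> norm (v1 - v3)}"
  have K_low: "(v1, v2, v3) \<in> K"
    if "norm v1 = r1" "norm v2 = r2" "norm v3 = r3" "v1 \<noteq> v2" "v2 \<noteq> v3" "v3 \<noteq> v1"
      "f (v1, v2, v3) \<le> F" for v1 v2 v3
  proof -
    have "0 < 1 / norm (v2 - v1)" "0 < 1 / norm (v3 - v2)" "0 < 1 / norm (v1 - v3)"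
      using that by auto
    then have "1 / norm (v2 - v1) \<le> F" "1 / norm (v3 - v2) \<le> F" "1 / norm (v1 - v3) \<le> F"
      using that(7) unfolding f_def prod.case by linarith+
    then show ?thesis
      using that F_pos unfolding K_def by (auto simp: field_simps)
  qed
  have "closed {(v1 :: real ^ 2, v2 :: real ^ 2, v3 :: real ^ 2).
       1 / F \<le> norm (v2 - v1) \<and> 1 / F \<le> norm (v3 - v2) \<and> 1 / F \<le> norm (v1 - v3)}"
    unfolding case_prod_unfold
    by (intro closed_Collect_conj closed_Collect_le continuous_intros)
  then have "compact K"
    unfolding K_def by (intro compact_Int_closed compact_Times compact_sphere)
  moreover have "(w1, w2, w3) \<in> K"
    by (rule K_low) (use w in \<open>simp_all add: F_def\<close>)
  moreover have "continuous_on K f"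
    using F_pos unfolding f_def case_prod_unfold K_def
    by (intro continuous_intros) (auto simp: field_simps)
  ultimately obtain p where p: "p \<in> K" "\<And>q. q \<in> K \<Longrightarrow> f p \<le> f q"
    using continuous_attains_inf[of K f] by blast
  have "f p \<le> e" if e: "e \<in> ?S" for e
  proof (cases "e \<le> F")
    case True
    obtain v1 v2 v3 :: "real ^ 2" where v: "norm v1 = r1" "norm v2 = r2" "norm v3 = r3"
        "v1 \<noteq> v2" "v2 \<noteq> v3" "v3 \<noteq> v1" "e = f (v1, v2, v3)"
      using e unfolding coulomb_energies_def f_def prod.case by blast
    then show ?thesis
      using K_low True p(2) by metis
  next
    case False
    then show ?thesis
      using p(2)[OF \<open>(w1, w2, w3) \<in> K\<close>] by (simp add: F_def)
  qed
  moreover have "f p \<in> ?S"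
  proof -
    obtain v1 v2 v3 where v: "p = (v1, v2, v3)"
      by (cases p)
    have "1 / F > 0"
      using F_pos by simp
    then have "v1 \<noteq> v2" "v2 \<noteq> v3" "v3 \<noteq> v1"
      using p(1) F_pos unfolding v K_def by (auto simp: not_le)
    moreover have "norm v1 = r1" "norm v2 = r2" "norm v3 = r3"
      using p(1) unfolding v K_def by auto
    ultimately show ?thesis
      unfolding coulomb_energies_def v f_def by auto
  qed
  ultimately have "coulomb_cost r1 r2 r3 = f p"
    unfolding coulomb_cost_def by (intro cInf_eq_minimum) auto
  with \<open>f p \<in> ?S\<close> show "coulomb_cost r1 r2 r3 \<in> ?S"
    by simp
qed

abbreviation coulomb_cost3 :: "real ^ 3 \<Rightarrow> real" where
  "coulomb_cost3 x \<equiv> coulomb_cost (x $ 1) (x $ 2) (x $ 3)"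

(* swap_part p x y is X(x,y,p); the companion Y(x,y,p) is swap_part p y x. *)
definition swap_part :: "3 set \<Rightarrow> real ^ 3 \<Rightarrow> real ^ 3 \<Rightarrow> real ^ 3" where
  "swap_part p x y = (\<chi> i. if i \<in> p then x $ i else y $ i)"

definition c_monotone :: "(real ^ 3) set \<Rightarrow> bool" where
  "c_monotone \<Gamma> \<longleftrightarrow> \<Gamma> \<subseteq> Rplus3 \<and>
     (\<forall>x\<in>\<Gamma>. \<forall>y\<in>\<Gamma>. \<forall>p.
        coulomb_cost3 x + coulomb_cost3 y
          \<le> coulomb_cost3 (swap_part p x y) + coulomb_cost3 (swap_part p y x))"

definition non_atomic :: "'a measure \<Rightarrow> bool" where
  "non_atomic M \<longleftrightarrow>
     (\<forall>A\<in>sets M. emeasure M A > 0 \<longrightarrow>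
        (\<exists>B\<in>sets M. B \<subseteq> A \<and> 0 < emeasure M B \<and> emeasure M B < emeasure M A))"

(* The restriction of \<rho> to a set is rendered as a measure on the same space, namely the
   density of the indicator function of the set. *)
definition pushes_restriction ::
    "real measure \<Rightarrow> (real \<Rightarrow> real) \<Rightarrow> real set \<Rightarrow> real set \<Rightarrow> bool" where
  "pushes_restriction \<rho> T I J \<longleftrightarrow>
     distr (density \<rho> (indicator I)) \<rho> T = density \<rho> (indicator J)"

definition increasing_transport ::
    "real measure \<Rightarrow> (real \<Rightarrow> real) \<Rightarrow> real set \<Rightarrow> real set \<Rightarrow> bool" where
  "increasing_transport \<rho> T I J \<longleftrightarrow>
     pushes_restriction \<rho> T I J \<and> (\<exists>N\<in>null_sets \<rho>. mono_on (I - N) T)"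

definition decreasing_transport ::
    "real measure \<Rightarrow> (real \<Rightarrow> real) \<Rightarrow> real set \<Rightarrow> real set \<Rightarrow> bool" where
  "decreasing_transport \<rho> T I J \<longleftrightarrow>
     pushes_restriction \<rho> T I J \<and> (\<exists>N\<in>null_sets \<rho>. antimono_on (I - N) T)"

(* The DDI-map is determined only up to null sets; the predicate holds for each of its
   representatives.  Neither does it depend on the choice of d1 and d2, which are unique up
   to intervals of measure zero. *)
definition is_DDI_map :: "real measure \<Rightarrow> (real \<Rightarrow> real) \<Rightarrow> bool" where
  "is_DDI_map \<rho> T \<longleftrightarrow>
     T \<in> measurable \<rho> \<rho> \<and> distr \<rho> \<rho> T = \<rho> \<and>
     (\<exists>d1\<in>Rplus. \<exists>d2\<in>Rplus.
        measure \<rho> {0<..d1} = 1/3 \<and> measure \<rho> {d1..d2} = 1/3 \<and> measure \<rho> {d2..} = 1/3 \<and>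
        decreasing_transport \<rho> T {0<..<d1} {d1<..<d2} \<and>
        decreasing_transport \<rho> T {d1<..<d2} {d2<..} \<and>
        increasing_transport \<rho> T {d2<..} {0<..<d1})"

definition transport_plan :: "real measure \<Rightarrow> (real \<Rightarrow> real) \<Rightarrow> (real ^ 3) measure" where
  "transport_plan \<rho> T =
     distr \<rho> (restrict_space borel Rplus3) (\<lambda>r. vector [r, T r, T (T r)])"

(* Topological support, relative to the subspace on which the measure lives. *)
definition measure_support :: "'a::topological_space measure \<Rightarrow> 'a set" where
  "measure_support \<mu> =
     {x \<in> space \<mu>. \<forall>U. open U \<longrightarrow> x \<in> U \<longrightarrow> emeasure \<mu> (U \<inter> space \<mu>) > 0}"

end

theory Submission
  imports Defs
begin

text \<open>
  Take M = 1000. For a in [1,2], b in [3,4] and z \<ge> 1000 the optimal configuration is collinear,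
  with the charges at a and z on the same side of the origin and the one at b on the other, so
  the cost is 1 / (a + b) + 1 / (z - a) + 1 / (z + b). The support of the plan consists of such
  triples (a, b, z) up to cyclic rotation. For two triples with the same rotation,
  c-monotonicity is the convexity of 1 / x, because along the DDI-map b decreases and z
  increases with a. For two triples with different rotations it follows, with a gap that is
  uniform in the far charges, from the lower bound of the cost by the sum of the
  1 / (r_i + r_j). Both situations are described by closed conditions on pairs of triples,
  hence pass from almost every point of the graph to the support.
\<close>

section \<open>Energy of three charges compared with the collinear configuration\<close>

text \<open>The map s -> 1 / sqrt s is convex, and the right-hand side is its tangent at s = q^2,
  evaluated at q^2 + 2 t = p^2. It bounds reciprocal distances by expressions linear in squared
  distances.\<close>

lemma inverse_ge_tangent_in_square:
  fixes p q t :: real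
  assumes "p > 0" "q > 0" "p\<^sup>2 = q\<^sup>2 + 2 * t"
  shows "1 / p \<ge> 1 / q - t / q ^ 3"
proof -
  have "0 \<le> (p - q)\<^sup>2 * (p + 2 * q)"
    using assms by simp
  \<comment> \<open>The exact remainder of the tangent: its numerator p^3 - 3 p q^2 + 2 q^3 has the
    double root p = q.\<close>
  moreover have "1 / p - 1 / q + t / q ^ 3 = (p - q)\<^sup>2 * (p + 2 * q) / (2 * p * q ^ 3)"
  proof -
    have t: "t = (p\<^sup>2 - q\<^sup>2) / 2"
      using assms(3) by simp
    show ?thesis
      unfolding t power2_eq_square power3_eq_cube using assms(1,2) by (simp add: field_simps)
  qed
  ultimately show ?thesis
    using assms by (smt (verit) divide_nonneg_pos mult_pos_pos zero_less_power)
qed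

text \<open>The law of cosines with the angle expressed by the chord between the directions. The
  scalars may be negative, so that opposite directions are covered as well.\<close>

lemma norm_diff_scaleR_unit:
  fixes u w :: "'a :: real_inner"
  assumes "norm u = 1" "norm w = 1"
  shows "(norm (s *\<^sub>R u - t *\<^sub>R w))\<^sup>2 = (s - t)\<^sup>2 + s * t * (norm (u - w))\<^sup>2"
proof -
  have "u \<bullet> u = 1" "w \<bullet> w = 1"
    using assms by (simp_all add: dot_square_norm)
  then show ?thesis
    unfolding power2_norm_eq_inner
    by (simp add: inner_commute algebra_simps power2_eq_square)
qed

text \<open>The triangle inequality through -w, squared by Young's inequality; the weights 5 and 5/4
  have reciprocals 1/5 + 4/5 = 1.\<close>

lemma norm_diff_weighted_triangle:
  fixes u v w :: "'a :: real_inner"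
  shows "(norm (u - v))\<^sup>2 \<le> 5 * (norm (u + w))\<^sup>2 + 5 / 4 * (norm (w + v))\<^sup>2"
proof -
  have "norm (u - v) \<le> norm (u + w) + norm (w + v)"
    using norm_triangle_ineq4[of "u + w" "w + v"] by simp
  then have "(norm (u - v))\<^sup>2 \<le> (norm (u + w) + norm (w + v))\<^sup>2"
    by (simp add: power_mono)
  also have "\<dots> \<le> 5 * (norm (u + w))\<^sup>2 + 5 / 4 * (norm (w + v))\<^sup>2"
    using zero_le_power2[of "2 * norm (u + w) - norm (w + v) / 2"]
    by (simp add: power2_eq_square algebra_simps)
  finally show ?thesis .
qed

text \<open>Leaving the collinear position lowers only the energy of \<open>v1\<close> and
  \<open>v3\<close>, which are closest when aligned; it raises that of the other two pairs. The
  misalignment of \<open>v1\<close> and \<open>v3\<close> is controlled by their deviations from the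
  direction opposite to \<open>v2\<close>, so the gain of the other pairs pays for the loss.\<close>

lemma coulomb_energy_ge_collinear:
  fixes v1 v2 v3 :: "'a :: real_inner"
  assumes "1 \<le> norm v1" "norm v1 \<le> 2" "3 \<le> norm v2" "norm v2 \<le> 4" "1000 \<le> norm v3"
    and distinct: "v1 \<noteq> v2" "v2 \<noteq> v3" "v3 \<noteq> v1"
  shows "1 / (norm v1 + norm v2) + 1 / (norm v3 - norm v1) + 1 / (norm v3 + norm v2)
    \<le> 1 / norm (v2 - v1) + 1 / norm (v3 - v2) + 1 / norm (v1 - v3)"
proof -
  define a b z where "a = norm v1" and "b = norm v2" and "z = norm v3"
  note abz = a_def b_def z_def
  have bounds: "1 \<le> a" "a \<le> 2" "3 \<le> b" "b \<le> 4" "1000 \<le> z"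
    using assms by (simp_all add: abz)
  define u w e where "u = v1 /\<^sub>R a" and "w = v2 /\<^sub>R b" and "e = v3 /\<^sub>R z"
  have unit: "norm u = 1" "norm w = 1" "norm e = 1" "norm (- w) = 1"
    using bounds by (simp_all add: u_def w_def e_def flip: abz)
  have v: "v1 = a *\<^sub>R u" "v2 = b *\<^sub>R w" "v3 = z *\<^sub>R e"
    using bounds by (simp_all add: u_def w_def e_def)
  \<comment> \<open>All three defects vanish exactly when \<open>v1\<close> and \<open>v3\<close>
    are aligned and \<open>v2\<close> is opposite to both.\<close>
  define A B C where "A = (norm (u + w))\<^sup>2" and "B = (norm (w + e))\<^sup>2" and "C = (norm (u - e))\<^sup>2"
  have nonneg: "0 \<le> A" "0 \<le> B" "0 \<le> C"
    by (simp_all add: A_def B_def C_def)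
  \<comment> \<open>Here \<open>v2\<close> is read as -b times -w, so that the deviation is measured
    from the opposite direction.\<close>
  have "(norm (v2 - v1))\<^sup>2 = (a + b)\<^sup>2 + 2 * (- (a * b * A / 2))"
    using norm_diff_scaleR_unit[OF unit(1,4), of a "- b"]
    by (simp add: v A_def norm_minus_commute)
  then have D: "1 / norm (v2 - v1) \<ge> 1 / (a + b) - (- (a * b * A / 2)) / (a + b) ^ 3"
    using distinct bounds by (intro inverse_ge_tangent_in_square) auto
  have "(norm (v3 - v2))\<^sup>2 = (z + b)\<^sup>2 + 2 * (- (b * z * B / 2))"
    using norm_diff_scaleR_unit[OF unit(3,4), of z "- b"]
    by (simp add: v B_def add.commute mult.commute mult.left_commute)
  then have Q: "1 / norm (v3 - v2) \<ge> 1 / (z + b) - (- (b * z * B / 2)) / (z + b) ^ 3"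
    using distinct bounds by (intro inverse_ge_tangent_in_square) auto
  have "(norm (v1 - v3))\<^sup>2 = (z - a)\<^sup>2 + 2 * (a * z * C / 2)"
    using norm_diff_scaleR_unit[OF unit(1,3), of a z]
    by (simp add: v C_def power2_commute)
  then have P: "1 / norm (v1 - v3) \<ge> 1 / (z - a) - (a * z * C / 2) / (z - a) ^ 3"
    using distinct bounds by (intro inverse_ge_tangent_in_square) auto
  (* The weight 5 / 4 of B has to stay below b / a, which is at least 3 / 2; the weight 5 of A
     is then harmless, because the coefficient of C is of order 1 / z^2. *)
  have "a * z / (z - a) ^ 3 * C \<le> a * z / (z - a) ^ 3 * (5 * A + 5 / 4 * B)"
    unfolding A_def B_def C_def
    using bounds by (intro mult_left_mono norm_diff_weighted_triangle) auto
  also have "\<dots> = 5 * z / (z - a) ^ 3 * a * A + 5 * a / (4 * (z - a) ^ 3) * z * B"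
    by (simp add: algebra_simps add_divide_distrib)
  also have "\<dots> \<le> b / (a + b) ^ 3 * a * A + b / (z + b) ^ 3 * z * B"
  proof (intro add_mono mult_right_mono)
    \<comment> \<open>Uses a + b <= 6 and z - 2 >= 998: the right side is cubic in z, the left side
      only linear.\<close>
    have "5 * z * (a + b) ^ 3 \<le> 5 * z * 6 ^ 3"
      using bounds by (intro mult_left_mono power_mono) auto
    also have "\<dots> \<le> 3 * (998\<^sup>2 * (z - 2))"
      using bounds by simp
    also have "\<dots> \<le> 3 * ((z - 2)\<^sup>2 * (z - 2))"
      using bounds by (intro mult_left_mono mult_right_mono power_mono) auto
    also have "\<dots> = 3 * (z - 2) ^ 3"
      by (simp add: power3_eq_cube power2_eq_square)
    also have "\<dots> \<le> b * (z - a) ^ 3"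
      using bounds by (intro mult_mono power_mono) auto
    finally show "5 * z / (z - a) ^ 3 \<le> b / (a + b) ^ 3"
      using bounds by (simp add: frac_le_eq divide_le_0_iff field_simps)
    \<comment> \<open>For z >= 302 one has z + 4 <= 51/50 (z - 2), and the cube of 51/50 is below
      6/5; this is what 5 * 2 * (51/50)^3 <= 4 * 3 requires.\<close>
    have "a * (z + b) ^ 3 \<le> 2 * (51 / 50 * (z - 2)) ^ 3"
      using bounds by (intro mult_mono power_mono) auto
    moreover have "3 * (z - 2) ^ 3 \<le> b * (z - a) ^ 3"
      using bounds by (intro mult_mono power_mono) auto
    moreover have "(51 / 50 * (z - 2)) ^ 3 = 132651 / 125000 * (z - 2) ^ 3"
      unfolding power_mult_distrib by (simp add: power_divide)
    moreover have "0 \<le> (z - 2) ^ 3"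
      using bounds by simp
    ultimately have "5 * (a * (z + b) ^ 3) \<le> 4 * (b * (z - a) ^ 3)"
      by linarith
    then show "5 * a / (4 * (z - a) ^ 3) \<le> b / (z + b) ^ 3"
      using bounds by (simp add: field_simps)
  qed (use bounds nonneg in auto)
  finally have "a * z * C / 2 / (z - a) ^ 3 \<le> a * b * A / 2 / (a + b) ^ 3 + b * z * B / 2 / (z + b) ^ 3"
    by (simp add: field_simps)
  with D Q P show ?thesis
    unfolding abz[symmetric] by simp
qed

section \<open>Rotation invariance, a lower bound and the collinear value of the cost\<close>

lemma coulomb_energies_rotate: "coulomb_energies r2 r3 r1 = coulomb_energies r1 r2 r3"
proof -
  \<comment> \<open>One application gives one inclusion and two give the other, since the rotation
    has order three.\<close>
  have "coulomb_energies s1 s2 s3 \<subseteq> coulomb_energies s3 s1 s2" for s1 s2 s3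
  proof
    fix x
    assume "x \<in> coulomb_energies s1 s2 s3"
    then obtain v1 v2 v3 :: "real ^ 2" where v: "norm v1 = s1" "norm v2 = s2" "norm v3 = s3"
        "v1 \<noteq> v2" "v2 \<noteq> v3" "v3 \<noteq> v1"
      and x: "x = 1 / norm (v2 - v1) + 1 / norm (v3 - v2) + 1 / norm (v1 - v3)"
      unfolding coulomb_energies_def by blast
    have "x = 1 / norm (v1 - v3) + 1 / norm (v2 - v1) + 1 / norm (v3 - v2)"
      using x by simp
    with v show "x \<in> coulomb_energies s3 s1 s2"
      unfolding coulomb_energies_def by blast
  qed
  then show ?thesis
    by blast
qed

lemma coulomb_cost_rotate: "coulomb_cost r2 r3 r1 = coulomb_cost r1 r2 r3"
  by (simp add: coulomb_cost_def coulomb_energies_rotate)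

text \<open>Charges at radii r_i and r_j are at most r_i + r_j apart. This crude bound serves for
  the swapped triples with two charges in the same region, where no explicit cost is
  available.\<close>

lemma coulomb_cost_ge:
  assumes "r1 > 0" "r2 > 0" "r3 > 0"
  shows "1 / (r1 + r2) + 1 / (r2 + r3) + 1 / (r3 + r1) \<le> coulomb_cost r1 r2 r3"
proof -
  obtain v1 v2 v3 :: "real ^ 2" where v: "norm v1 = r1" "norm v2 = r2" "norm v3 = r3"
      "v1 \<noteq> v2" "v2 \<noteq> v3" "v3 \<noteq> v1"
    and c: "coulomb_cost r1 r2 r3 = 1 / norm (v2 - v1) + 1 / norm (v3 - v2) + 1 / norm (v1 - v3)"
    using coulomb_cost_minimum(1)[OF assms] unfolding coulomb_energies_def by blast
  have "1 / (norm x + norm y) \<le> 1 / norm (y - x)" if "x \<noteq> y" for x y :: "real ^ 2"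
  proof (rule divide_left_mono)
    show "norm (y - x) \<le> norm x + norm y"
      using norm_triangle_ineq4[of y x] by simp
    moreover have "0 < norm (y - x)"
      using that by simp
    ultimately show "0 < (norm x + norm y) * norm (y - x)"
      by (intro mult_pos_pos) linarith+
  qed simp
  from this[OF v(4)] this[OF v(5)] this[OF v(6)] show ?thesis
    unfolding c v(1-3) by linarith
qed

lemma coulomb_cost_collinear:
  assumes "a \<in> {1..2}" "b \<in> {3..4}" "z \<in> {1000..}"
  shows "coulomb_cost a b z = 1 / (a + b) + 1 / (z - a) + 1 / (z + b)"
proof (rule antisym)
  have pos: "a > 0" "b > 0" "z > 0"
    using assms by auto
  define v1 v2 v3 :: "real ^ 2"
    where "v1 = vector [a, 0]" and "v2 = vector [- b, 0]" and "v3 = vector [z, 0]"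
  have "norm v1 = a" "norm v2 = b" "norm v3 = z"
    using pos by (simp_all add: v1_def v2_def v3_def norm_vec_def L2_set_def sum_2)
  moreover have "v1 $ 1 \<noteq> v2 $ 1" "v2 $ 1 \<noteq> v3 $ 1" "v3 $ 1 \<noteq> v1 $ 1"
    using assms by (simp_all add: v1_def v2_def v3_def)
  then have "v1 \<noteq> v2" "v2 \<noteq> v3" "v3 \<noteq> v1"
    by auto
  ultimately have "1 / norm (v2 - v1) + 1 / norm (v3 - v2) + 1 / norm (v1 - v3) \<in> coulomb_energies a b z"
    unfolding coulomb_energies_def by blast
  moreover have "norm (v2 - v1) = a + b" "norm (v3 - v2) = z + b" "norm (v1 - v3) = z - a"
    using assms by (simp_all add: v1_def v2_def v3_def norm_vec_def L2_set_def sum_2)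
  ultimately have "1 / (a + b) + 1 / (z + b) + 1 / (z - a) \<in> coulomb_energies a b z"
    by simp
  from coulomb_cost_minimum(2)[OF pos this]
  show "coulomb_cost a b z \<le> 1 / (a + b) + 1 / (z - a) + 1 / (z + b)"
    by simp
  obtain v1 v2 v3 :: "real ^ 2" where v: "norm v1 = a" "norm v2 = b" "norm v3 = z"
      "v1 \<noteq> v2" "v2 \<noteq> v3" "v3 \<noteq> v1"
    and c: "coulomb_cost a b z = 1 / norm (v2 - v1) + 1 / norm (v3 - v2) + 1 / norm (v1 - v3)"
    using coulomb_cost_minimum(1)[OF pos] unfolding coulomb_energies_def by blast
  show "1 / (a + b) + 1 / (z - a) + 1 / (z + b) \<le> coulomb_cost a b z"
    unfolding c using coulomb_energy_ge_collinear[of v1 v2 v3] v assms by auto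
qed

section \<open>Swap inequalities for two triples\<close>

text \<open>Complementing \<open>p\<close> interchanges the two swapped triples, and the empty and
  the full set give equality. Of the eight choices of \<open>p\<close> only the exchanges of a
  single coordinate remain. The radii are separate arguments so that a rotation is a permutation of
  them.\<close>

definition swap_nonimproving :: "real \<Rightarrow> real \<Rightarrow> real \<Rightarrow> real \<Rightarrow> real \<Rightarrow> real \<Rightarrow> bool" where
  "swap_nonimproving x1 x2 x3 y1 y2 y3 \<longleftrightarrow>
     coulomb_cost x1 x2 x3 + coulomb_cost y1 y2 y3
       \<le> coulomb_cost y1 x2 x3 + coulomb_cost x1 y2 y3 \<and>
     coulomb_cost x1 x2 x3 + coulomb_cost y1 y2 y3
       \<le> coulomb_cost x1 y2 x3 + coulomb_cost y1 x2 y3 \<and>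
     coulomb_cost x1 x2 x3 + coulomb_cost y1 y2 y3
       \<le> coulomb_cost x1 x2 y3 + coulomb_cost y1 y2 x3"

lemma swap_nonimproving_commute:
  "swap_nonimproving x1 x2 x3 y1 y2 y3 \<longleftrightarrow> swap_nonimproving y1 y2 y3 x1 x2 x3"
  by (auto simp: swap_nonimproving_def)

lemma swap_nonimproving_rotate:
  "swap_nonimproving x2 x3 x1 y2 y3 y1 \<longleftrightarrow> swap_nonimproving x1 x2 x3 y1 y2 y3"
  unfolding swap_nonimproving_def coulomb_cost_rotate[of _ x3 x1] coulomb_cost_rotate[of _ y3 x1]
    coulomb_cost_rotate[of _ x3 y1] coulomb_cost_rotate[of _ y3 y1] by auto

lemma swap_part_cost_le:
  assumes "swap_nonimproving (x $ 1) (x $ 2) (x $ 3) (y $ 1) (y $ 2) (y $ 3)"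
  shows "coulomb_cost3 x + coulomb_cost3 y
    \<le> coulomb_cost3 (swap_part p x y) + coulomb_cost3 (swap_part p y x)"
  using assms unfolding swap_nonimproving_def swap_part_def
  by (cases "1 \<in> p"; cases "2 \<in> p"; cases "3 \<in> p") simp_all

text \<open>Convexity of 1 / x: s + d and t lie between s and t + d and have the same sum.\<close>

lemma inverse_add_ge:
  fixes s t d :: real
  assumes "0 < s" "s \<le> t" "0 \<le> d"
  shows "1 / (s + d) + 1 / t \<le> 1 / s + 1 / (t + d)"
proof -
  have "d / (t * (t + d)) \<le> d / (s * (s + d))"
    using assms by (intro divide_left_mono mult_mono) auto
  moreover have "1 / t - 1 / (t + d) = d / (t * (t + d))" "1 / s - 1 / (s + d) = d / (s * (s + d))"
    using assms by (simp_all add: field_simps)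
  ultimately show ?thesis
    by simp
qed

text \<open>The distances a + b and z + b favour pairing large with small, the distance z - a
  favours large with large. Swapped triples stay in the region of the explicit formula, and each
  exchange alters two of the three pair terms.\<close>

lemma swap_nonimproving_same_block:
  assumes "a \<in> {1..2}" "b \<in> {3..4}" "z \<in> {1000..}" "a' \<in> {1..2}" "b' \<in> {3..4}" "z' \<in> {1000..}"
    and "a \<le> a'" "b' \<le> b" "z \<le> z'"
  shows "swap_nonimproving a b z a' b' z'"
proof -
  have "1 / (a + b) + 1 / (a' + b') \<le> 1 / (a' + b) + 1 / (a + b')"
    using inverse_add_ge[of "a + b'" "a' + b'" "b - b'"] assms by (simp add: add.commute)
  moreover have "1 / (z - a) + 1 / (z' - a') \<le> 1 / (z - a') + 1 / (z' - a)"
    using inverse_add_ge[of "z - a'" "z' - a'" "a' - a"] assms by simp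
  moreover have "1 / (z + b) + 1 / (z' + b') \<le> 1 / (z + b') + 1 / (z' + b)"
    using inverse_add_ge[of "z + b'" "z' + b'" "b - b'"] assms by simp
  ultimately show ?thesis
    unfolding swap_nonimproving_def
      coulomb_cost_collinear[OF assms(1,2,3)] coulomb_cost_collinear[OF assms(4,5,6)]
      coulomb_cost_collinear[OF assms(4,2,3)] coulomb_cost_collinear[OF assms(1,5,6)]
      coulomb_cost_collinear[OF assms(1,5,3)] coulomb_cost_collinear[OF assms(4,2,6)]
      coulomb_cost_collinear[OF assms(1,2,6)] coulomb_cost_collinear[OF assms(4,5,3)]
    by simp
qed

text \<open>One exchange puts the two near charges into one triple and the two middle ones into the
  other; the remaining two put both far charges into one triple and leave the other without any.
  Each raises the cost by more than 2/499, which bounds all terms with a far charge before the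
  exchange.\<close>

lemma swap_nonimproving_rotated_block:
  assumes ab: "a \<in> {1..2}" "b \<in> {3..4}" "z \<in> {1000..}"
    and ab': "a' \<in> {1..2}" "b' \<in> {3..4}" "z' \<in> {1000..}"
  shows "swap_nonimproving a b z b' z' a'"
proof -
  have pos: "0 < a" "0 < b" "0 < z" "0 < a'" "0 < b'" "0 < z'"
    using assms by auto
  have upper: "coulomb_cost a b z \<le> 1 / (a + b) + 1 / 499"
    if "a \<in> {1..2}" "b \<in> {3..4}" "z \<in> {1000..}" for a b z :: real
  proof -
    have "1 / (z - a) \<le> 1 / 998" "1 / (z + b) \<le> 1 / 998"
      using that by (auto intro!: divide_left_mono)
    then show ?thesis
      unfolding coulomb_cost_collinear[OF that] by simp
  qed
  have "coulomb_cost b' z' a' = coulomb_cost a' b' z'"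
    by (rule coulomb_cost_rotate)
  with upper[OF ab] upper[OF ab'] have u:
    "coulomb_cost a b z + coulomb_cost b' z' a' \<le> 1 / (a + b) + 1 / (a' + b') + 2 / 499"
    by simp
  have inv_pos: "0 < 1 / (s + t)" if "0 < s" "0 < t" for s t :: real
    using that by simp
  have inv_ge: "1 / k \<le> 1 / (s + t)" if "0 < s" "0 < t" "s + t \<le> k" for s t k :: real
    using that by (intro divide_left_mono) auto
  have inv_le: "1 / (s + t) \<le> 1 / k" if "0 < k" "k \<le> s + t" for s t k :: real
    using that by (intro divide_left_mono) auto
  have "1 / (a + b) + 1 / (a' + b') + 2 / 499 \<le> 1 / (a' + a) + 1 / (b' + b)"
  proof -
    \<comment> \<open>Both pairs of denominators have the sum a + a' + b + b', and their products
      differ by (b - a')(b' - a). The resulting gap is at least 8/1152 = 1/144 > 2/499.\<close>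
    have "8 * (1 * 1) \<le> (a + a' + b + b') * ((b - a') * (b' - a))"
      using assms by (intro mult_mono) auto
    moreover have "(a + a') * (b + b') * ((a + b) * (a' + b')) \<le> 4 * 8 * (6 * 6)"
      using assms by (intro mult_mono) auto
    ultimately have "8 / (4 * 8 * (6 * 6)) \<le> (a + a' + b + b') * ((b - a') * (b' - a))
        / ((a + a') * (b + b') * ((a + b) * (a' + b')))"
      using pos by (intro frac_le) auto
    also have "\<dots> = 1 / (a' + a) + 1 / (b' + b) - 1 / (a + b) - 1 / (a' + b')"
      using pos by (simp add: divide_simps add_pos_pos less_imp_neq[symmetric]) (auto simp: add_eq_0_iff algebra_simps)
    finally show ?thesis
      by simp
  qed
  moreover have "1 / (b' + b) \<le> coulomb_cost b' b z"
    using coulomb_cost_ge[of b' b z] inv_pos[of b z] inv_pos[of z b'] pos by linarith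
  moreover have "1 / (a' + a) \<le> coulomb_cost a z' a'"
    using coulomb_cost_ge[of a z' a'] inv_pos[of a z'] inv_pos[of z' a'] pos by linarith
  ultimately have 1: "coulomb_cost a b z + coulomb_cost b' z' a'
      \<le> coulomb_cost b' b z + coulomb_cost a z' a'"
    using u by linarith
  have "0 \<le> coulomb_cost a z' z"
    using coulomb_cost_ge[of a z' z] inv_pos[of a z'] inv_pos[of z' z] inv_pos[of z a] pos by linarith
  \<comment> \<open>The term 1 / (a' + b') is common to both sides; what remains is 1/4 + 2/499 <=
    1/6 + 1/8.\<close>
  moreover have "1 / (a + b) + 1 / (a' + b') + 2 / 499 \<le> coulomb_cost b' b a'"
  proof -
    have "1 / (a + b) \<le> 1 / 4" "1 / 6 \<le> 1 / (b + a')" "1 / 8 \<le> 1 / (b' + b)"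
      using assms by (auto intro!: inv_le inv_ge)
    then show ?thesis
      using coulomb_cost_ge[of b' b a'] pos by linarith
  qed
  ultimately have 2: "coulomb_cost a b z + coulomb_cost b' z' a'
      \<le> coulomb_cost a z' z + coulomb_cost b' b a'"
    using u by linarith
  have "0 \<le> coulomb_cost b' z' z"
    using coulomb_cost_ge[of b' z' z] inv_pos[of b' z'] inv_pos[of z' z] inv_pos[of z b'] pos by linarith
  \<comment> \<open>Now 1 / (a + b) is common, and 1/4 + 2/499 <= 1/6 + 1/4 remains.\<close>
  moreover have "1 / (a + b) + 1 / (a' + b') + 2 / 499 \<le> coulomb_cost a b a'"
  proof -
    have "1 / (a' + b') \<le> 1 / 4" "1 / 6 \<le> 1 / (b + a')" "1 / 4 \<le> 1 / (a' + a)"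
      using assms by (auto intro!: inv_le inv_ge)
    then show ?thesis
      using coulomb_cost_ge[of a b a'] pos by linarith
  qed
  ultimately have 3: "coulomb_cost a b z + coulomb_cost b' z' a'
      \<le> coulomb_cost a b a' + coulomb_cost b' z' z"
    using u by linarith
  from 1 2 3 show ?thesis
    by (simp add: swap_nonimproving_def)
qed

section \<open>A closed relation on pairs of triples\<close>

text \<open>
  The near charge is at index i, the middle one at j and the far one at k, so that the three
  branches of the DDI-map give the index triples 1 2 3, 3 1 2 and 2 3 1.
\<close>

definition cell :: "3 \<Rightarrow> 3 \<Rightarrow> 3 \<Rightarrow> (real ^ 3) set" where
  "cell i j k = {x. x $ i \<in> {1..2} \<and> x $ j \<in> {3..4} \<and> x $ k \<in> {1000..}}"

text \<open>Weak inequalities and the union over both orders make the relation closed and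
  symmetric.\<close>

definition monotone_pairs :: "3 \<Rightarrow> 3 \<Rightarrow> 3 \<Rightarrow> ((real ^ 3) \<times> (real ^ 3)) set" where
  "monotone_pairs i j k =
     {(x, y). x $ i \<le> y $ i \<and> y $ j \<le> x $ j \<and> x $ k \<le> y $ k} \<union>
     {(x, y). y $ i \<le> x $ i \<and> x $ j \<le> y $ j \<and> y $ k \<le> x $ k}"

definition DDI_pairs :: "((real ^ 3) \<times> (real ^ 3)) set" where
  "DDI_pairs =
     (cell 1 2 3 \<times> cell 1 2 3 \<inter> monotone_pairs 1 2 3) \<union>
     (cell 3 1 2 \<times> cell 3 1 2 \<inter> monotone_pairs 3 1 2) \<union>
     (cell 2 3 1 \<times> cell 2 3 1 \<inter> monotone_pairs 2 3 1) \<union>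
     cell 1 2 3 \<times> (cell 3 1 2 \<union> cell 2 3 1) \<union>
     cell 3 1 2 \<times> (cell 2 3 1 \<union> cell 1 2 3) \<union>
     cell 2 3 1 \<times> (cell 1 2 3 \<union> cell 3 1 2)"

lemma closed_DDI_pairs: "closed DDI_pairs"
proof -
  have "closed (cell i j k)" for i j k
    unfolding cell_def atLeastAtMost_iff atLeast_iff
    by (intro closed_Collect_conj closed_Collect_le continuous_intros)
  moreover have "closed (monotone_pairs i j k)" for i j k
    unfolding monotone_pairs_def case_prod_unfold
    by (intro closed_Un closed_Collect_conj closed_Collect_le continuous_intros)
  ultimately show ?thesis
    unfolding DDI_pairs_def by (intro closed_Un closed_Int closed_Times)
qed

lemma swap_nonimproving_DDI_pairs:
  assumes "(x, y) \<in> DDI_pairs"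
  shows "swap_nonimproving (x $ 1) (x $ 2) (x $ 3) (y $ 1) (y $ 2) (y $ 3)"
proof -
  have same: "swap_nonimproving (x $ i) (x $ j) (x $ k) (y $ i) (y $ j) (y $ k)"
    if "(x, y) \<in> cell i j k \<times> cell i j k \<inter> monotone_pairs i j k" for i j k
    using that
      swap_nonimproving_same_block[of "x $ i" "x $ j" "x $ k" "y $ i" "y $ j" "y $ k"]
      swap_nonimproving_same_block[of "y $ i" "y $ j" "y $ k" "x $ i" "x $ j" "x $ k"]
      swap_nonimproving_commute[of "x $ i" "x $ j" "x $ k" "y $ i" "y $ j" "y $ k"]
    unfolding cell_def monotone_pairs_def by blast
  \<comment> \<open>Of two different cells one arises from the other by passing from i j k to k i j,
    so up to exchanging \<open>x\<close> and \<open>y\<close> all mixed pairs are covered.\<close>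
  have different: "swap_nonimproving (x $ i) (x $ j) (x $ k) (y $ i) (y $ j) (y $ k)"
    if "x \<in> cell i j k" "y \<in> cell k i j" for x y :: "real ^ 3" and i j k
    using that swap_nonimproving_rotated_block unfolding cell_def by blast
  have rotate:
    "swap_nonimproving (x $ 3) (x $ 1) (x $ 2) (y $ 3) (y $ 1) (y $ 2) \<longleftrightarrow> ?thesis"
    "swap_nonimproving (x $ 2) (x $ 3) (x $ 1) (y $ 2) (y $ 3) (y $ 1) \<longleftrightarrow> ?thesis"
    by (metis swap_nonimproving_rotate)+
  show ?thesis
    using assms same[of 1 2 3] same[of 3 1 2] same[of 2 3 1]
      different[of x 1 2 3 y] different[of x 3 1 2 y] different[of x 2 3 1 y]
      different[of y 1 2 3 x] different[of y 3 1 2 x] different[of y 2 3 1 x]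
    unfolding DDI_pairs_def rotate
    by (auto simp: rotate swap_nonimproving_commute[of "y $ _"])
qed

lemma c_monotone_DDI_pairs:
  assumes "\<Gamma> \<times> \<Gamma> \<subseteq> DDI_pairs" "\<Gamma> \<subseteq> Rplus3"
  shows "c_monotone \<Gamma>"
  using assms swap_part_cost_le swap_nonimproving_DDI_pairs unfolding c_monotone_def by blast

section \<open>Supports of image measures and almost everywhere statements\<close>

text \<open>The complement of the closure is open with null preimage, so it misses the support. Open
  sets are intersected with the space of \<open>N\<close> to allow for a measure living on a
  subspace.\<close>

lemma measure_support_distr_subset:
  assumes f: "f \<in> measurable M N" and open_sets: "\<And>U. open U \<Longrightarrow> U \<inter> space N \<in> sets N"
    and Q: "AE x in M. Q x"
  shows "measure_support (distr M N f) \<subseteq> closure (f ` {x \<in> space M. Q x})"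
proof
  fix y
  assume y: "y \<in> measure_support (distr M N f)"
  show "y \<in> closure (f ` {x \<in> space M. Q x})"
  proof (rule ccontr)
    let ?U = "- closure (f ` {x \<in> space M. Q x})"
    assume "y \<notin> closure (f ` {x \<in> space M. Q x})"
    then have "open ?U" "y \<in> ?U"
      by auto
    then have "0 < emeasure (distr M N f) (?U \<inter> space (distr M N f))"
      using y unfolding measure_support_def by blast
    then have "0 < emeasure (distr M N f) (?U \<inter> space N)"
      by simp
    moreover have "AE x in M. f x \<notin> ?U \<inter> space N"
      using Q AE_space
    proof eventually_elim
      case (elim x)
      then show ?case
        using closure_subset[of "f ` {x \<in> space M. Q x}"] by auto
    qed
    then have "emeasure M {x \<in> space M. f x \<in> ?U \<inter> space N} = 0"
      by (intro emeasure_eq_0_AE)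
    moreover have "f -` (?U \<inter> space N) \<inter> space M = {x \<in> space M. f x \<in> ?U \<inter> space N}"
      by blast
    moreover have "?U \<inter> space N \<in> sets N"
      by (intro open_sets) auto
    then have "emeasure (distr M N f) (?U \<inter> space N) = emeasure M (f -` (?U \<inter> space N) \<inter> space M)"
      by (intro emeasure_distr f)
    ultimately show False
      by simp
  qed
qed

lemma non_atomic_AE_neq:
  assumes "non_atomic M" "{d} \<in> sets M"
  shows "AE x in M. x \<noteq> d"
proof -
  have "emeasure M {d} = 0"
  proof (rule ccontr)
    assume "emeasure M {d} \<noteq> 0"
    then obtain B where B: "B \<subseteq> {d}" "0 < emeasure M B" "emeasure M B < emeasure M {d}"
      using assms unfolding non_atomic_def by (metis zero_less_iff_neq_zero)
    then have "B = {} \<or> B = {d}"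
      by auto
    with B show False
      by auto
  qed
  with assms have "{d} \<in> null_sets M"
    by auto
  from AE_not_in[OF this] show ?thesis
    by simp
qed

text \<open>Serves to identify the intervals cut off by \<open>d1\<close> and \<open>d2\<close> with
  the prescribed ones: two initial or two final segments are nested, whichever end point is
  larger.\<close>

lemma (in prob_space) AE_iff_of_nested:
  assumes "A \<in> events" "B \<in> events" "A \<subseteq> B \<or> B \<subseteq> A" "prob A = prob B"
  shows "AE x in M. x \<in> A \<longleftrightarrow> x \<in> B"
proof -
  have sub: "AE x in M. x \<in> A \<longleftrightarrow> x \<in> B"
    if "A \<in> events" "B \<in> events" "A \<subseteq> B" "prob A = prob B" for A B
  proof -
    have "prob (B - A) = 0"
      using that by (simp add: finite_measure_Diff)
    then have "B - A \<in> null_sets M"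
      using that by (simp add: null_sets_def emeasure_eq_measure)
    from AE_not_in[OF this] show ?thesis
      by eventually_elim (use that in auto)
  qed
  show ?thesis
    using assms(3)
  proof
    assume "B \<subseteq> A"
    from sub[OF assms(2,1) this] assms(4) show ?thesis
      by auto
  qed (use sub assms in auto)
qed

lemma AE_pushes_restriction:
  assumes "pushes_restriction \<rho> T I J" "T \<in> measurable \<rho> \<rho>" "I \<in> sets \<rho>" "J \<in> sets \<rho>"
  shows "AE x in \<rho>. x \<in> I \<longrightarrow> T x \<in> J"
proof -
  have "AE y in density \<rho> (indicator J). y \<in> J"
    using assms by (subst AE_density) (auto simp: indicator_def)
  then have "AE y in distr (density \<rho> (indicator I)) \<rho> T. y \<in> J"
    using assms(1) by (simp only: pushes_restriction_def)
  then have "AE x in density \<rho> (indicator I). T x \<in> J"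
    by (rule AE_distrD[rotated]) (use assms in simp)
  then show ?thesis
    using assms by (subst (asm) AE_density) auto
qed

lemma transport_plan_map_measurable:
  assumes sets: "sets \<rho> = sets (restrict_space borel Rplus)" and T: "T \<in> measurable \<rho> \<rho>"
  shows "(\<lambda>r. vector [r, T r, T (T r)] :: real ^ 3) \<in> measurable \<rho> (restrict_space borel Rplus3)"
proof (rule measurable_restrict_space2)
  have space: "space \<rho> = Rplus"
    using sets_eq_imp_space_eq[OF sets] by (simp add: space_restrict_space)
  have id: "(\<lambda>r. r) \<in> borel_measurable \<rho>"
    by (subst measurable_cong_sets[OF sets refl]) (rule measurable_restrict_space1, simp)
  have T': "T \<in> borel_measurable \<rho>"
    using measurable_compose[OF T id] by simp
  have T2: "(\<lambda>r. T (T r)) \<in> borel_measurable \<rho>"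
    using measurable_compose[OF T T'] by simp
  show "(\<lambda>r. vector [r, T r, T (T r)] :: real ^ 3) \<in> borel_measurable \<rho>"
    using id T' T2 unfolding borel_measurable_euclidean_space[where ?'c = "real ^ 3"]
    by (auto simp: Basis_vec_def inner_axis UNIV_3)
  show "(\<lambda>r. vector [r, T r, T (T r)] :: real ^ 3) \<in> space \<rho> \<rightarrow> Rplus3"
    using measurable_space[OF T] by (auto simp: space forall_3)
qed

section \<open>Monotonicity along the orbits of the DDI-map and passage to the support\<close>

theorem proposition2p9:
  shows "\<exists>M::real. M > 4 \<and>
    (\<forall>(\<rho> :: real measure) (T :: real \<Rightarrow> real).
       prob_space \<rho> \<longrightarrow> sets \<rho> = sets (restrict_space borel Rplus) \<longrightarrow> non_atomic \<rho> \<longrightarrow>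
       measure \<rho> {1..2} = 1/3 \<longrightarrow> measure \<rho> {3..4} = 1/3 \<longrightarrow> measure \<rho> {M..} = 1/3 \<longrightarrow>
       is_DDI_map \<rho> T \<longrightarrow>
       c_monotone (measure_support (transport_plan \<rho> T)))"
proof (intro exI[of _ 1000] conjI allI impI)
  fix \<rho> :: "real measure" and T :: "real \<Rightarrow> real"
  assume "prob_space \<rho>" and sets: "sets \<rho> = sets (restrict_space borel Rplus)"
    and na: "non_atomic \<rho>"
    and third: "measure \<rho> {1..2} = 1/3" "measure \<rho> {3..4} = 1/3" "measure \<rho> {1000..} = 1/3"
    and DDI: "is_DDI_map \<rho> T"
  interpret prob_space \<rho> by fact
  have space: "space \<rho> = Rplus"
    using sets_eq_imp_space_eq[OF sets] by (simp add: space_restrict_space)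
  have sets_iff: "A \<in> sets \<rho> \<longleftrightarrow> A \<in> sets borel \<and> A \<subseteq> Rplus" for A
    unfolding sets by (subst sets_restrict_space_iff) auto
  from DDI obtain d1 d2 where T: "T \<in> measurable \<rho> \<rho>" "distr \<rho> \<rho> T = \<rho>"
    and d: "0 < d1" "0 < d2" "prob {0<..d1} = 1/3" "prob {d1..d2} = 1/3" "prob {d2..} = 1/3"
    and transport: "decreasing_transport \<rho> T {0<..<d1} {d1<..<d2}"
      "decreasing_transport \<rho> T {d1<..<d2} {d2<..}" "increasing_transport \<rho> T {d2<..} {0<..<d1}"
    unfolding is_DDI_map_def by auto
  have "d1 \<le> d2"
    using d(4) by (rule_tac ccontr) simp
  obtain N1 N2 N3 where N: "N1 \<in> null_sets \<rho>" "N2 \<in> null_sets \<rho>" "N3 \<in> null_sets \<rho>"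
    and mono: "antimono_on ({0<..<d1} - N1) T" "antimono_on ({d1<..<d2} - N2) T"
      "mono_on ({d2<..} - N3) T"
    using transport unfolding decreasing_transport_def increasing_transport_def by blast
  have intervals: "{0<..<d1} \<in> events" "{d1<..<d2} \<in> events" "{d2<..} \<in> events"
    using d(1,2) by (auto simp: sets_iff)
  have pushes: "pushes_restriction \<rho> T {0<..<d1} {d1<..<d2}"
      "pushes_restriction \<rho> T {d1<..<d2} {d2<..}" "pushes_restriction \<rho> T {d2<..} {0<..<d1}"
    using transport unfolding decreasing_transport_def increasing_transport_def by blast+
  note images = AE_pushes_restriction[OF pushes(1) T(1) intervals(1,2)]
    AE_pushes_restriction[OF pushes(2) T(1) intervals(2,3)]
    AE_pushes_restriction[OF pushes(3) T(1) intervals(3,1)]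
  have events: "{1..2} \<in> events" "{3..4} \<in> events" "{1000..} \<in> events"
    by (auto simp: sets_iff)
  have "prob ({1..2} \<union> {3..4} \<union> {1000..}) = prob ({1..2} \<union> {3..4}) + prob {1000..}"
    using events by (intro finite_measure_Union) auto
  also have "prob ({1..2} \<union> {3..4}) = prob {1..2} + prob {3..4}"
    using events by (intro finite_measure_Union) auto
  finally have "prob ({1..2} \<union> {3..4} \<union> {1000..}) = 1"
    using third by simp
  then have "AE r in \<rho>. r \<in> {1..2} \<union> {3..4} \<union> {1000..}"
    by (rule AE_prob_1)
  note cover = this
  \<comment> \<open>Almost all mass lies in the three prescribed intervals, so
    \<open>{0<..2}\<close> has mass 1/3 and can be compared with \<open>{0<..d1}\<close>, which also
    starts at 0.\<close>
  have "prob {0<..2} = prob {1..2}"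
    by (rule finite_measure_eq_AE) (use cover in \<open>auto simp: sets_iff\<close>)
  then have low: "AE r in \<rho>. r \<in> {0<..d1} \<longleftrightarrow> r \<in> {0<..2}"
    using d third by (intro AE_iff_of_nested) (auto simp: sets_iff)
  have high: "AE r in \<rho>. r \<in> {d2..} \<longleftrightarrow> r \<in> {1000..}"
    using d third by (intro AE_iff_of_nested) (auto simp: sets_iff)
  have ne: "AE r in \<rho>. r \<noteq> d1" "AE r in \<rho>. r \<noteq> d2"
    using na d(1,2) by (auto intro!: non_atomic_AE_neq simp: sets_iff)
  define P where "P r \<longleftrightarrow> r \<notin> N1 \<and> r \<notin> N2 \<and> r \<notin> N3 \<and>
    (r \<in> {0<..<d1} \<and> r \<in> {1..2} \<and> T r \<in> {d1<..<d2} \<or>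
     r \<in> {d1<..<d2} \<and> r \<in> {3..4} \<and> T r \<in> {d2<..} \<or>
     r \<in> {d2<..} \<and> r \<in> {1000..} \<and> T r \<in> {0<..<d1})" for r
  \<comment> \<open>The middle block is what remains once the lower and the upper one are identified
    and \<open>d1\<close>, \<open>d2\<close> are discarded.\<close>
  have "AE r in \<rho>. r \<in> {0<..<d1} \<and> r \<in> {1..2} \<or> r \<in> {d1<..<d2} \<and> r \<in> {3..4} \<or>
      r \<in> {d2<..} \<and> r \<in> {1000..}"
    using cover low high ne
  proof eventually_elim
    case (elim r)
    from elim(1) show ?case
      by (elim UnE) (use elim(2-) in auto)
  qed
  then have P: "AE r in \<rho>. P r"
    using AE_not_in[OF N(1)] AE_not_in[OF N(2)] AE_not_in[OF N(3)] images
  proof eventually_elim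
    case (elim r)
    then show ?case
      unfolding P_def by blast
  qed
  \<comment> \<open>Since \<open>T\<close> preserves the measure, an almost sure property also holds
    almost surely at the image point; hence all three points of an orbit segment are good.\<close>
  have shift: "AE r in \<rho>. Q (T r)" if "AE r in \<rho>. Q r" for Q
  proof -
    from that have "AE r in distr \<rho> \<rho> T. Q r"
      by (simp only: T(2))
    then show ?thesis
      by (rule AE_distrD[OF T(1)])
  qed
  have Q: "AE r in \<rho>. P r \<and> P (T r) \<and> P (T (T r))"
    using P shift[OF P] shift[OF shift[OF P]] by eventually_elim simp
  define f where "f r = (vector [r, T r, T (T r)] :: real ^ 3)" for r
  define G where "G = f ` {r \<in> space \<rho>. P r \<and> P (T r) \<and> P (T (T r))}"
  have T1: "T s \<le> T r" if "r \<le> s" "r \<in> {0<..<d1} - N1" "s \<in> {0<..<d1} - N1" for r s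
    using monotone_onD[OF mono(1) that(2,3,1)] .
  have T2: "T s \<le> T r" if "r \<le> s" "r \<in> {d1<..<d2} - N2" "s \<in> {d1<..<d2} - N2" for r s
    using monotone_onD[OF mono(2) that(2,3,1)] .
  have T3: "T r \<le> T s" if "r \<le> s" "r \<in> {d2<..} - N3" "s \<in> {d2<..} - N3" for r s
    using monotone_onD[OF mono(3) that(2,3,1)] .
  \<comment> \<open>The order of \<open>r\<close> and \<open>s\<close> is carried along the orbit by
    the monotone branches. In each cell the near and far charges move together and the middle one
    against them; different cells impose no order.\<close>
  have wlog: "(f r, f s) \<in> DDI_pairs \<and> (f s, f r) \<in> DDI_pairs"
    if rs: "r \<le> s" "P r" "P (T r)" "P (T (T r))" "P s" "P (T s)" "P (T (T s))" for r s
  proof -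
    have cells: "r \<in> {0<..<d1} \<and> T r \<in> {d1<..<d2} \<and> T (T r) \<in> {d2<..} \<and> f r \<in> cell 1 2 3 \<or>
       r \<in> {d1<..<d2} \<and> T r \<in> {d2<..} \<and> T (T r) \<in> {0<..<d1} \<and> f r \<in> cell 3 1 2 \<or>
       r \<in> {d2<..} \<and> T r \<in> {0<..<d1} \<and> T (T r) \<in> {d1<..<d2} \<and> f r \<in> cell 2 3 1"
      if "P r" "P (T r)" "P (T (T r))" for r
    proof -
      have low: "r \<in> {1..2} \<and> T r \<in> {d1<..<d2}" if "r \<in> {0<..<d1}" "P r" for r
        using that \<open>d1 \<le> d2\<close> unfolding P_def by auto
      have middle: "r \<in> {3..4} \<and> T r \<in> {d2<..}" if "r \<in> {d1<..<d2}" "P r" for r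
        using that \<open>d1 \<le> d2\<close> unfolding P_def by auto
      have high: "r \<in> {1000..} \<and> T r \<in> {0<..<d1}" if "r \<in> {d2<..}" "P r" for r
        using that \<open>d1 \<le> d2\<close> unfolding P_def by auto
      from \<open>P r\<close> consider "r \<in> {0<..<d1}" | "r \<in> {d1<..<d2}" | "r \<in> {d2<..}"
        unfolding P_def by blast
      then show ?thesis
      proof cases
        case 1
        note first = low[OF this that(1)]
        note second = middle[OF conjunct2[OF first] that(2)]
        note third = high[OF conjunct2[OF second] that(3)]
        have "f r \<in> cell 1 2 3"
          using first second third unfolding f_def cell_def by simp
        with 1 first second show ?thesis
          by blast
      next
        case 2
        note first = middle[OF this that(1)]
        note second = high[OF conjunct2[OF first] that(2)]
        note third = low[OF conjunct2[OF second] that(3)]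
        have "f r \<in> cell 3 1 2"
          using first second third unfolding f_def cell_def by simp
        with 2 first second show ?thesis
          by blast
      next
        case 3
        note first = high[OF this that(1)]
        note second = low[OF conjunct2[OF first] that(2)]
        note third = middle[OF conjunct2[OF second] that(3)]
        have "f r \<in> cell 2 3 1"
          using first second third unfolding f_def cell_def by simp
        with 3 first second show ?thesis
          by blast
      qed
    qed
    have N: "r \<notin> N1" "r \<notin> N2" "r \<notin> N3" "T r \<notin> N1" "T r \<notin> N2" "T r \<notin> N3"
      "s \<notin> N1" "s \<notin> N2" "s \<notin> N3" "T s \<notin> N1" "T s \<notin> N2" "T s \<notin> N3"
      using rs unfolding P_def by blast+
    from cells[OF rs(2-4)] show ?thesis
    proof (elim disjE conjE)
      assume r: "r \<in> {0<..<d1}" "T r \<in> {d1<..<d2}" "T (T r) \<in> {d2<..}" "f r \<in> cell 1 2 3"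
      from cells[OF rs(5-7)] show ?thesis
      proof (elim disjE conjE)
        assume s: "s \<in> {0<..<d1}" "T s \<in> {d1<..<d2}" "T (T s) \<in> {d2<..}" "f s \<in> cell 1 2 3"
        have "T s \<le> T r"
          using T1[OF rs(1)] r s N by blast
        moreover from this have "T (T r) \<le> T (T s)"
          by (rule T2) (use r s N in blast)+
        ultimately have "(f r, f s) \<in> monotone_pairs 1 2 3" "(f s, f r) \<in> monotone_pairs 1 2 3"
          using rs(1) by (simp_all add: monotone_pairs_def f_def)
        with r s show ?thesis
          unfolding DDI_pairs_def by blast
      qed (use r in \<open>unfold DDI_pairs_def, blast+\<close>)
    next
      assume r: "r \<in> {d1<..<d2}" "T r \<in> {d2<..}" "T (T r) \<in> {0<..<d1}" "f r \<in> cell 3 1 2"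
      from cells[OF rs(5-7)] show ?thesis
      proof (elim disjE conjE)
        assume s: "s \<in> {d1<..<d2}" "T s \<in> {d2<..}" "T (T s) \<in> {0<..<d1}" "f s \<in> cell 3 1 2"
        have "T s \<le> T r"
          using T2[OF rs(1)] r s N by blast
        moreover from this have "T (T s) \<le> T (T r)"
          by (rule T3) (use r s N in blast)+
        ultimately have "(f r, f s) \<in> monotone_pairs 3 1 2" "(f s, f r) \<in> monotone_pairs 3 1 2"
          using rs(1) by (simp_all add: monotone_pairs_def f_def)
        with r s show ?thesis
          unfolding DDI_pairs_def by blast
      qed (use r in \<open>unfold DDI_pairs_def, blast+\<close>)
    next
      assume r: "r \<in> {d2<..}" "T r \<in> {0<..<d1}" "T (T r) \<in> {d1<..<d2}" "f r \<in> cell 2 3 1"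
      from cells[OF rs(5-7)] show ?thesis
      proof (elim disjE conjE)
        assume s: "s \<in> {d2<..}" "T s \<in> {0<..<d1}" "T (T s) \<in> {d1<..<d2}" "f s \<in> cell 2 3 1"
        have "T r \<le> T s"
          using T3[OF rs(1)] r s N by blast
        moreover from this have "T (T s) \<le> T (T r)"
          by (rule T1) (use r s N in blast)+
        ultimately have "(f r, f s) \<in> monotone_pairs 2 3 1" "(f s, f r) \<in> monotone_pairs 2 3 1"
          using rs(1) by (simp_all add: monotone_pairs_def f_def)
        with r s show ?thesis
          unfolding DDI_pairs_def by blast
      qed (use r in \<open>unfold DDI_pairs_def, blast+\<close>)
    qed
  qed
  have "G \<times> G \<subseteq> DDI_pairs"
  proof -
    have "(f r, f s) \<in> DDI_pairs"
      if "P r" "P (T r)" "P (T (T r))" "P s" "P (T s)" "P (T (T s))" for r s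
      using that wlog[of r s] wlog[of s r] by (cases "r \<le> s") auto
    then show ?thesis
      unfolding G_def by blast
  qed
  \<comment> \<open>The closure of a product is the product of the closures, so the relation extends
    to all pairs of limit points.\<close>
  then have "closure G \<times> closure G \<subseteq> DDI_pairs"
    unfolding closure_Times[symmetric] by (rule closure_minimal) (rule closed_DDI_pairs)
  moreover have "U \<inter> space (restrict_space borel Rplus3) \<in> sets (restrict_space borel Rplus3)"
    if "open U" for U
    using that by (auto simp: space_restrict_space sets_restrict_space Int_commute intro!: image_eqI[of _ _ U])
  then have "measure_support (transport_plan \<rho> T) \<subseteq> closure G"
    unfolding transport_plan_def G_def f_def
    by (rule measure_support_distr_subset[OF transport_plan_map_measurable[OF sets T(1)] _ Q])
  moreover have "measure_support (transport_plan \<rho> T) \<subseteq> Rplus3"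
    unfolding measure_support_def transport_plan_def by (auto simp: space_restrict_space)
  ultimately show "c_monotone (measure_support (transport_plan \<rho> T))"
    by (intro c_monotone_DDI_pairs) blast+
qed simp

end
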